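(* Let $f_1,\dots,f_m:\mathbb{R}^d\to\mathbb{R}$ each be convex and $L$-smooth, and let $x^\star$ be an optimal solution of $\min_{x\in\mathbb{R}^d}\frac1m\sum_{i=1}^m f_i(x)$; put $X^\star=1(x^\star)^\top$. Let $A\in\mathbb{R}^{m\times m}$, $B,C\in\mathbb{S}^m$ satisfy: (i) $A=BD$ with $B\succeq0$ and $0\prec D\in\mathbb{S}^m$; (ii) $D1=1$ and $1^\top B=1^\top$; (iii) $C\succeq0$ and $\mathrm{Null}(C)=\mathrm{span}(1)$; (iv) $B$ and $C$ commute; (v) $I-\frac12C-\sqrt B D\sqrt B\succeq0$. Let $X^0\in\mathbb{R}^{m\times d}$ be arbitrary, $Y^0=0$, and for $k\ge0$ $$X^{k+1}=AX^k-\gamma B\nabla f(X^k)-Y^k,\qquad Y^{k+1}=Y^k+CX^{k+1}.$$ If $0<\gamma\le\frac{\lambda_{\min}(D)}{L}$, then for every $k\ge1$, with $\widehat X^k=\frac1k\sum_{t=1}^kX^t$, $$M(\widehat X^k)\le\frac1k\left(\frac1{2\gamma}\|X^0-X^\star\|_D^2+2\gamma\,\frac{\rho(B-J)}{\lambda_2(C)}\,\|\nabla f(X^\star)\|^2\right),$$ where $M(X)=\max\big\{\|(I-J)X\|\,\|\nabla f(X^\star)\|,\;|f(X)-f(X^\star)|\big\}$.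
   Context: $\mathbb{S}^m$ is the set of real symmetric $m\times m$ matrices; $\preceq,\prec$ denote the Loewner order. $1\in\mathbb{R}^m$ is the all-ones vector and $J=\frac1m11^\top$. For $X=[x_1,\dots,x_m]^\top\in\mathbb{R}^{m\times d}$ (row $i$ is $x_i^\top$), $f(X)=\sum_{i=1}^m f_i(x_i)$ and $\nabla f(X)=[\nabla f_1(x_1),\dots,\nabla f_m(x_m)]^\top$. "$L$-smooth" means differentiable with $L$-Lipschitz gradient. $\|\cdot\|$ is the Frobenius norm and $\|X\|_D^2=\mathrm{tr}(X^\top DX)$. $\rho(\cdot)$ is the spectral radius, $\lambda_{\min}$ the smallest eigenvalue, and $\lambda_2(C)$ the second smallest eigenvalue of $C$. *)

theory Defs
  imports "HOL-Analysis.Analysis"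
begin

definition psd :: "real^'m^'m \<Rightarrow> bool"
  where "psd M \<longleftrightarrow> transpose M = M \<and> (\<forall>x. 0 \<le> x \<bullet> (M *v x))"

definition pos_def :: "real^'m^'m \<Rightarrow> bool"
  where "pos_def M \<longleftrightarrow> transpose M = M \<and> (\<forall>x. x \<noteq> 0 \<longrightarrow> 0 < x \<bullet> (M *v x))"

definition loewner_le :: "real^'m^'m \<Rightarrow> real^'m^'m \<Rightarrow> bool"
  where "loewner_le M N \<longleftrightarrow> psd (N - M)"

definition loewner_less :: "real^'m^'m \<Rightarrow> real^'m^'m \<Rightarrow> bool"
  where "loewner_less M N \<longleftrightarrow> pos_def (N - M)"

definition mat_sqrt :: "real^'m^'m \<Rightarrow> real^'m^'m"
  where "mat_sqrt M = (THE S. psd S \<and> S ** S = M)"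

definition eigenvals :: "'a::field^'m^'m \<Rightarrow> 'a set"
  where "eigenvals M = {\<mu>. \<exists>v. v \<noteq> 0 \<and> M *v v = \<mu> *s v}"

(* Complex eigenvalues, so that this is the spectral radius of any real square matrix. *)
definition spectral_radius :: "real^'m^'m \<Rightarrow> real"
  where "spectral_radius M = Max (cmod ` eigenvals (\<chi> i j. complex_of_real (M $ i $ j)))"

(* For symmetric M: the eigenvalues in increasing order, each repeated according to its
   multiplicity (for symmetric matrices this is the dimension of the eigenspace). *)
definition eig_list :: "real^'m^'m \<Rightarrow> real list"
  where "eig_list M =
    (THE xs. sorted xs \<and> (\<forall>\<mu>. count_list xs \<mu> = dim {v :: real^'m. M *v v = \<mu> *s v}))"

definition lambda_min :: "real^'m^'m \<Rightarrow> real"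
  where "lambda_min M = eig_list M ! 0"

(* Unspecified if CARD('m) = 1, where there is no second eigenvalue. *)
definition lambda2 :: "real^'m^'m \<Rightarrow> real"
  where "lambda2 M = eig_list M ! 1"

definition avg_mat :: "real^'m^'m"
  where "avg_mat = (\<chi> i j. 1 / real CARD('m))"

definition grad :: "('a::real_inner \<Rightarrow> real) \<Rightarrow> 'a \<Rightarrow> 'a"
  where "grad f x = (THE g. GDERIV f x :> g)"

definition smooth :: "real \<Rightarrow> ('a::real_inner \<Rightarrow> real) \<Rightarrow> bool"
  where "smooth L f \<longleftrightarrow> (\<forall>x. f differentiable at x) \<and> L-lipschitz_on UNIV (grad f)"

definition total_fun :: "('m::finite \<Rightarrow> real^'d \<Rightarrow> real) \<Rightarrow> real^'d^'m \<Rightarrow> real"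
  where "total_fun f X = (\<Sum>i\<in>UNIV. f i (X $ i))"

definition stacked_grad :: "('m::finite \<Rightarrow> real^'d \<Rightarrow> real) \<Rightarrow> real^'d^'m \<Rightarrow> real^'d^'m"
  where "stacked_grad f X = (\<chi> i. grad (f i) (X $ i))"

(* The matrix 1 x^T, all of whose rows are x. *)
definition consensus :: "real^'d \<Rightarrow> real^'d^'m"
  where "consensus x = (\<chi> i. x)"

definition wnorm_sq :: "real^'m^'m \<Rightarrow> real^'d^'m \<Rightarrow> real"
  where "wnorm_sq D X = trace (transpose X ** D ** X)"

(* The library norm on real^'d^'m is the Frobenius norm. *)
definition merit :: "('m::finite \<Rightarrow> real^'d \<Rightarrow> real) \<Rightarrow> real^'d^'m \<Rightarrow> real^'d^'m \<Rightarrow> real"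
  where "merit f Xs X =
    max (norm ((mat 1 - avg_mat) ** X) * norm (stacked_grad f Xs))
        \<bar>total_fun f X - total_fun f Xs\<bar>"

end

(* Write R for the square root of B. The iterates factor as X(n+1) = R R W(n) and
   Y(n) = B C S(n), where W(n) = D X(n) - gamma grad f(X(n)) - C S(n) and
   S(n) = W(0) + ... + W(n-1). By convexity and smoothness, gamma (f(X(n+1)) - f(Xs)) is at most
   the decrease of the energy (|X(n) - Xs|_D^2 + |R S(n)|_C^2) / 2; condition (v) absorbs exactly
   the terms quadratic in R W(n). Summing and using Jensen bounds f at the average from above.
   From below, f at the average exceeds f(Xs) by at least -|grad f(Xs)| times the consensus error,
   which is controlled by |R S(k)|_C, hence by the upper bound; a quadratic inequality closes
   the loop. The spectral facts come from minimising the Rayleigh quotient over an invariant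
   subspace. *)
theory Submission
  imports Defs
begin

subsection \<open>Symmetric matrices\<close>

lemma symmetric_inner:
  fixes M :: "real^'m^'m"
  assumes "transpose M = M"
  shows "x \<bullet> (M *v y) = (M *v x) \<bullet> y"
  by (metis assms dot_lmul_matrix transpose_matrix_vector)

lemma symmetric_eigenvectors_orthogonal:
  fixes M :: "real^'m^'m"
  assumes "transpose M = M" "M *v v = a *\<^sub>R v" "M *v w = b *\<^sub>R w" "a \<noteq> b"
  shows "v \<bullet> w = 0"
  using symmetric_inner[OF assms(1), of v w] assms(2-4) by simp

text \<open>Along the line \<open>v + t w\<close> with \<open>w = N v\<close> the form is a
  polynomial in \<open>t\<close> without constant term; staying nonnegative for both signs of
  \<open>t\<close> forces its linear coefficient, twice the squared norm of \<open>w\<close>, to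
  vanish. The restriction to an invariant \<open>S\<close> allows use on orthogonal complements of
  eigenvectors.\<close>

lemma psd_on_null_imp_ker:
  fixes N :: "real^'m^'m"
  assumes sym: "transpose N = N" and S: "subspace S" and inv: "\<And>x. x \<in> S \<Longrightarrow> N *v x \<in> S"
    and nonneg: "\<And>x. x \<in> S \<Longrightarrow> 0 \<le> x \<bullet> (N *v x)"
    and v: "v \<in> S" "v \<bullet> (N *v v) = 0"
  shows "N *v v = 0"
proof -
  define w where "w = N *v v"
  have w: "w \<in> S" using inv v by (simp add: w_def)
  define c where "c = w \<bullet> (N *v w)"
  have c: "0 \<le> c" using nonneg w c_def by simp
  have quad: "0 \<le> 2 * t * (w \<bullet> w) + t\<^sup>2 * c" for t :: real
  proof -
    have "v + t *\<^sub>R w \<in> S" using S v w by (simp add: subspace_add subspace_scale)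
    then have "0 \<le> (v + t *\<^sub>R w) \<bullet> (N *v (v + t *\<^sub>R w))" by (rule nonneg)
    also have "\<dots> = v \<bullet> (N *v v) + t * (v \<bullet> (N *v w)) + t * (w \<bullet> (N *v v)) + t\<^sup>2 * c"
      by (simp add: algebra_simps inner_add_left inner_add_right c_def power2_eq_square)
    also have "\<dots> = 2 * t * (w \<bullet> w) + t\<^sup>2 * c"
      using v symmetric_inner[OF sym, of v w] by (simp add: w_def inner_commute)
    finally show ?thesis .
  qed
  have "w \<bullet> w = 0"
  proof (rule ccontr)
    assume "w \<bullet> w \<noteq> 0"
    then have p: "0 < w \<bullet> w" using inner_ge_zero[of w] by linarith
    \<comment> \<open>A small negative parameter lets the linear term win: \<open>t = -u\<close>
      gives the value \<open>-u^2 (c + 2)\<close>. The \<open>+ 1\<close> keeps the denominator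
      positive when \<open>c = 0\<close>.\<close>
    define u where "u = (w \<bullet> w) / (c + 1)"
    have u: "0 < u" "w \<bullet> w = u * (c + 1)" using p c by (simp_all add: u_def)
    have "2 * (- u) * (w \<bullet> w) + (- u)\<^sup>2 * c = - (u\<^sup>2 * (c + 2))"
      unfolding u(2) by (simp add: algebra_simps power2_eq_square)
    also have "\<dots> < 0" using u c by simp
    finally show False using quad[of "- u"] by simp
  qed
  then show ?thesis by (simp add: w_def)
qed

text \<open>The form attains its minimum on the compact unit sphere of \<open>S\<close>. There
  \<open>M - \<mu> I\<close> is nonnegative on \<open>S\<close> and has value zero at the minimiser,
  so the previous lemma makes it an eigenvector.\<close>

lemma rayleigh_minimum:
  fixes M :: "real^'m^'m"
  assumes sym: "transpose M = M" and S: "subspace S" and inv: "\<And>x. x \<in> S \<Longrightarrow> M *v x \<in> S"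
    and nz: "z \<in> S" "z \<noteq> 0"
  obtains v \<mu> where "v \<in> S" "norm v = 1" "M *v v = \<mu> *\<^sub>R v"
    "\<And>x. x \<in> S \<Longrightarrow> \<mu> * (x \<bullet> x) \<le> x \<bullet> (M *v x)"
proof -
  let ?K = "sphere 0 1 \<inter> S"
  have "compact ?K" using closed_subspace[OF S] by (simp add: compact_Int_closed)
  moreover have "(1 / norm z) *\<^sub>R z \<in> ?K" using nz S by (simp add: subspace_scale)
  then have "?K \<noteq> {}" by blast
  moreover have "continuous_on ?K (\<lambda>x. x \<bullet> (M *v x))"
    by (intro continuous_intros)
  ultimately have "\<exists>v\<in>?K. \<forall>x\<in>?K. v \<bullet> (M *v v) \<le> x \<bullet> (M *v x)"
    by (rule continuous_attains_inf)
  then obtain v where v: "v \<in> ?K" and min: "\<And>x. x \<in> ?K \<Longrightarrow> v \<bullet> (M *v v) \<le> x \<bullet> (M *v x)"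
    by blast
  define \<mu> where "\<mu> = v \<bullet> (M *v v)"
  have bound: "\<mu> * (x \<bullet> x) \<le> x \<bullet> (M *v x)" if "x \<in> S" for x
  proof (cases "x = 0")
    case False
    have "(1 / norm x) *\<^sub>R x \<in> ?K" using False that S by (simp add: subspace_scale)
    from min[OF this] have "\<mu> \<le> (x \<bullet> (M *v x)) / (norm x)\<^sup>2"
      by (simp add: \<mu>_def matrix_vector_mult_scaleR power2_eq_square)
    then show ?thesis using False by (simp add: pos_le_divide_eq power2_norm_eq_inner)
  qed simp
  define N where "N = M - \<mu> *\<^sub>R mat 1"
  have N: "N *v x = M *v x - \<mu> *\<^sub>R x" for x
    by (simp add: N_def matrix_vector_mult_diff_rdistrib flip: scaleR_matrix_vector_assoc)
  have "N *v v = 0"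
  proof (rule psd_on_null_imp_ker[of N S])
    show "transpose N = N"
      using sym by (auto simp: N_def transpose_def vec_eq_iff mat_def)
    show "0 \<le> x \<bullet> (N *v x)" if "x \<in> S" for x
      using bound[OF that] by (simp add: N inner_diff_right)
    have "v \<bullet> v = 1" using v by (simp add: norm_eq_1)
    then show "v \<bullet> (N *v v) = 0" by (simp add: N inner_diff_right \<mu>_def)
  qed (use S inv v in \<open>auto simp: N subspace_diff subspace_scale\<close>)
  then show ?thesis using that[of v \<mu>] v bound by (simp add: N)
qed

text \<open>Take an orthonormal set of eigenvectors of largest cardinality. Symmetry makes its
  orthogonal complement invariant, so a Rayleigh minimiser in a nonzero complement would enlarge the
  set.\<close>

lemma orthonormal_eigenbasis:
  fixes M :: "real^'m^'m"
  assumes sym: "transpose M = M"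
  obtains E ev where "pairwise orthogonal E" "\<And>b. b \<in> E \<Longrightarrow> norm b = 1" "finite E" "span E = UNIV"
    "\<And>b. b \<in> E \<Longrightarrow> M *v b = ev b *\<^sub>R b"
proof -
  define P where "P E \<longleftrightarrow> pairwise orthogonal E \<and> (\<forall>b\<in>E. norm b = 1 \<and> (\<exists>\<mu>. M *v b = \<mu> *\<^sub>R b))"
    for E :: "(real^'m) set"
  have P_fin: "finite E \<and> card E \<le> DIM(real^'m)" if "P E" for E
  proof -
    have "independent E"
      using that by (intro pairwise_orthogonal_independent) (auto simp: P_def)
    then show ?thesis using independent_bound by blast
  qed
  have "P {}" by (simp add: P_def)
  then obtain E where E: "P E" and max: "\<And>F. P F \<Longrightarrow> card F \<le> card E"
    using ex_has_greatest_nat[of P "{}" card "Suc (DIM(real^'m))"] P_fin by (metis less_Suc_eq_le)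
  have "span E = UNIV"
  proof (rule ccontr)
    assume "span E \<noteq> UNIV"
    then obtain a where a: "a \<noteq> 0" "\<And>x. x \<in> span E \<Longrightarrow> a \<bullet> x = 0"
      using span_not_UNIV_orthogonal by blast
    define S where "S = {y. \<forall>x\<in>E. orthogonal x y}"
    have S: "subspace S" unfolding S_def by (rule subspace_orthogonal_to_vectors)
    have inv: "M *v y \<in> S" if "y \<in> S" for y
      unfolding S_def orthogonal_def
    proof (intro CollectI ballI)
      fix x assume x: "x \<in> E"
      with E obtain \<mu> where "M *v x = \<mu> *\<^sub>R x" by (auto simp: P_def)
      then show "x \<bullet> (M *v y) = 0"
        using symmetric_inner[OF sym, of x y] that x by (simp add: S_def orthogonal_def)
    qed
    have "a \<in> S" using a by (simp add: S_def orthogonal_def inner_commute span_base)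
    then obtain v \<mu> where v: "v \<in> S" "norm v = 1" "M *v v = \<mu> *\<^sub>R v"
      using rayleigh_minimum[OF sym S inv _ a(1)] by blast
    have "P (insert v E)"
      using E v by (auto simp: P_def pairwise_insert S_def orthogonal_commute)
    moreover have "v \<notin> E" using v by (auto simp: S_def orthogonal_def norm_eq_1)
    ultimately show False using max[of "insert v E"] P_fin[OF E] by simp
  qed
  moreover obtain ev where "\<And>b. b \<in> E \<Longrightarrow> M *v b = ev b *\<^sub>R b"
    using E unfolding P_def by metis
  moreover have "finite E" "pairwise orthogonal E" "\<And>b. b \<in> E \<Longrightarrow> norm b = 1"
    using E P_fin[OF E] by (auto simp: P_def)
  ultimately show ?thesis using that by blast
qed

lemma eigenbasis_eq:
  fixes M N :: "real^'m^'m"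
  assumes "span E = UNIV" "\<And>b. b \<in> E \<Longrightarrow> M *v b = N *v b"
  shows "M = N"
proof -
  have "M *v x = N *v x" for x
    by (rule linear_eq_on[of _ _ x E]) (use assms in auto)
  then show ?thesis by (simp add: matrix_eq)
qed

lemma finite_eigenvalues_symmetric:
  fixes M :: "real^'m^'m"
  assumes sym: "transpose M = M"
  shows "finite {\<mu>. \<exists>v. v \<noteq> 0 \<and> M *v v = \<mu> *\<^sub>R v}"
proof -
  obtain E ev where E: "finite E" "span E = UNIV" "\<And>b. b \<in> E \<Longrightarrow> M *v b = ev b *\<^sub>R b"
    using orthonormal_eigenbasis[OF sym] by metis
  have "{\<mu>. \<exists>v. v \<noteq> 0 \<and> M *v v = \<mu> *\<^sub>R v} \<subseteq> ev ` E"
  proof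
    fix \<mu> assume "\<mu> \<in> {\<mu>. \<exists>v. v \<noteq> 0 \<and> M *v v = \<mu> *\<^sub>R v}"
    then obtain v where v: "v \<noteq> 0" "M *v v = \<mu> *\<^sub>R v" by blast
    show "\<mu> \<in> ev ` E"
    proof (rule ccontr)
      assume "\<mu> \<notin> ev ` E"
      \<comment> \<open>Eigenvectors for different eigenvalues are orthogonal, so \<open>v\<close>
        would be orthogonal to a spanning set.\<close>
      then have "v \<bullet> b = 0" if "b \<in> E" for b
        using symmetric_eigenvectors_orthogonal[OF sym v(2) E(3)] that by blast
      then have "v = 0"
        using E(2) orthogonal_to_span[of v E v] by (auto simp: orthogonal_def)
      with v show False by simp
    qed
  qed
  then show ?thesis using E(1) finite_subset by blast
qed

section \<open>Positive semidefinite square roots\<close>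

lemma psd_sqrt_eigenvector:
  fixes S :: "real^'m^'m"
  assumes S: "psd S" and v: "(S ** S) *v v = (r\<^sup>2) *\<^sub>R v" and r: "0 \<le> r"
  shows "S *v v = r *\<^sub>R v"
proof -
  define w where "w = S *v v - r *\<^sub>R v"
  have sym: "transpose S = S" and pos: "0 \<le> x \<bullet> (S *v x)" for x
    using S by (auto simp: psd_def)
  have SS: "S *v (S *v v) = (r\<^sup>2) *\<^sub>R v" using v by (simp add: matrix_vector_mul_assoc)
  \<comment> \<open>This is \<open>(S + r)(S - r) = S^2 - r^2\<close> applied to \<open>v\<close>. A
    positive semidefinite \<open>S\<close> has no eigenvalue \<open>-r\<close> with
    \<open>r > 0\<close>, so \<open>w = 0\<close> unless \<open>r = 0\<close>; in that case the
    squared norm of \<open>S v\<close> is \<open>v . S^2 v = 0\<close>.\<close>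
  have "S *v w = - r *\<^sub>R w"
    by (simp add: w_def matrix_vector_mult_diff_distrib matrix_vector_mult_scaleR SS
        power2_eq_square scaleR_diff_right)
  then have "0 \<le> - r * (w \<bullet> w)" using pos[of w] by simp
  then have "r = 0 \<or> w = 0"
    using r by (metis inner_gt_zero_iff minus_mult_left mult_pos_pos neg_0_le_iff_le not_le order_less_le)
  moreover have "w = 0" if "r = 0"
    using symmetric_inner[OF sym, of v "S *v v"] SS that by (simp add: w_def)
  ultimately show ?thesis by (auto simp: w_def)
qed

lemma psd_sqrt_exists:
  fixes M :: "real^'m^'m"
  assumes M: "psd M"
  shows "\<exists>S. psd S \<and> S ** S = M"
proof -
  have sym: "transpose M = M" and pos: "0 \<le> x \<bullet> (M *v x)" for x
    using M by (auto simp: psd_def)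
  obtain E ev where orth: "pairwise orthogonal E" and E: "\<And>b. b \<in> E \<Longrightarrow> norm b = 1" "finite E"
      "span E = UNIV" "\<And>b. b \<in> E \<Longrightarrow> M *v b = ev b *\<^sub>R b"
    using orthonormal_eigenbasis[OF sym] by metis
  have ev: "0 \<le> ev b" if "b \<in> E" for b
    using pos[of b] E(1,4)[OF that] by (simp add: norm_eq_1)
  \<comment> \<open>The spectral decomposition of \<open>M\<close> with each eigenvalue replaced by
    its root.\<close>
  define s where "s x = (\<Sum>b\<in>E. (sqrt (ev b) * (x \<bullet> b)) *\<^sub>R b)" for x :: "real^'m"
  have lin: "linear s"
    by (auto simp: s_def linear_iff inner_add_left algebra_simps sum.distrib scaleR_sum_right)
  define S where "S = matrix s"
  have S: "S *v x = s x" for x using lin by (simp add: S_def matrix_works)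
  have s_E: "s b = sqrt (ev b) *\<^sub>R b" if "b \<in> E" for b
  proof -
    have "s b = (\<Sum>a\<in>E. if a = b then sqrt (ev b) *\<^sub>R b else 0)"
      unfolding s_def using orth E(1) that
      by (intro sum.cong) (auto simp: pairwise_def orthogonal_def norm_eq_1)
    then show ?thesis using that E(2) by simp
  qed
  have symS: "x \<bullet> s y = s x \<bullet> y" for x y
    by (simp add: s_def inner_sum_left inner_sum_right inner_commute mult_ac)
  have "transpose S = S"
  proof -
    have "transpose S *v x = S *v x" for x
      by (rule vector_eq_ldot[THEN iffD1])
        (metis S dot_lmul_matrix inner_commute symS transpose_matrix_vector)
    then show ?thesis by (simp add: matrix_eq)
  qed
  moreover have "0 \<le> x \<bullet> (S *v x)" for x
    unfolding S s_def inner_sum_right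
    by (rule sum_nonneg) (simp add: ev inner_commute mult.assoc)
  moreover have "S ** S = M"
  proof (rule eigenbasis_eq[OF E(3)])
    fix b assume b: "b \<in> E"
    then have "S *v (S *v b) = M *v b"
      using s_E[OF b] ev[OF b] E(4)[OF b] by (simp add: S linear_scale[OF lin])
    then show "(S ** S) *v b = M *v b" by (simp add: matrix_vector_mul_assoc)
  qed
  ultimately show ?thesis unfolding psd_def by blast
qed

lemma psd_sqrt_eigenvector_sqrt:
  fixes S :: "real^'m^'m"
  assumes "psd S" "S ** S = M" "psd M" "M *v v = \<mu> *\<^sub>R v"
  shows "S *v v = sqrt \<mu> *\<^sub>R v"
proof (cases "v = 0")
  case False
  have "0 \<le> v \<bullet> (M *v v)" using assms(3) by (simp add: psd_def)
  then have "0 \<le> \<mu>" using False assms(4)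
    by (auto simp: zero_le_mult_iff dest: leD)
  then have "(S ** S) *v v = ((sqrt \<mu>)\<^sup>2) *\<^sub>R v" "0 \<le> sqrt \<mu>" using assms by simp_all
  then show ?thesis using psd_sqrt_eigenvector assms(1) by blast
qed simp

text \<open>Any root acts on an eigenvector of \<open>M\<close> for \<open>\<mu>\<close> as
  multiplication by \<open>sqrt \<mu>\<close>, so two roots agree on an eigenbasis. This is the
  uniqueness on which the \<open>THE\<close> in \<open>mat_sqrt\<close> depends.\<close>

lemma mat_sqrt:
  fixes M :: "real^'m^'m"
  assumes M: "psd M"
  shows psd_mat_sqrt: "psd (mat_sqrt M)" and mat_sqrt_square: "mat_sqrt M ** mat_sqrt M = M"
proof -
  obtain E ev where E: "span E = UNIV" "\<And>b. b \<in> E \<Longrightarrow> M *v b = ev b *\<^sub>R b"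
    using orthonormal_eigenbasis M unfolding psd_def by metis
  have "\<exists>!S. psd S \<and> S ** S = M"
  proof (rule ex_ex1I[OF psd_sqrt_exists[OF M]])
    fix S T assume "psd S \<and> S ** S = M" "psd T \<and> T ** T = M"
    then show "S = T"
      by (intro eigenbasis_eq[OF E(1)]) (metis E(2) M psd_sqrt_eigenvector_sqrt)
  qed
  then have "psd (mat_sqrt M) \<and> mat_sqrt M ** mat_sqrt M = M"
    unfolding mat_sqrt_def by (rule theI')
  then show "psd (mat_sqrt M)" "mat_sqrt M ** mat_sqrt M = M" by auto
qed

lemma mat_sqrt_eigenvector:
  fixes M :: "real^'m^'m"
  assumes "psd M" "M *v v = \<mu> *\<^sub>R v"
  shows "mat_sqrt M *v v = sqrt \<mu> *\<^sub>R v"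
  using psd_sqrt_eigenvector_sqrt assms mat_sqrt by blast

text \<open>\<open>N\<close> maps each eigenspace of \<open>M\<close> into itself, and the root is a
  scalar on each of them.\<close>

lemma mat_sqrt_commute:
  fixes M N :: "real^'m^'m"
  assumes M: "psd M" and comm: "M ** N = N ** M"
  shows "mat_sqrt M ** N = N ** mat_sqrt M"
proof -
  obtain E ev where E: "span E = UNIV" "\<And>b. b \<in> E \<Longrightarrow> M *v b = ev b *\<^sub>R b"
    using orthonormal_eigenbasis M unfolding psd_def by metis
  show ?thesis
  proof (rule eigenbasis_eq[OF E(1)])
    fix b assume b: "b \<in> E"
    have "M *v (N *v b) = ev b *\<^sub>R (N *v b)"
      by (metis E(2)[OF b] comm matrix_vector_mul_assoc matrix_vector_mult_scaleR)
    from mat_sqrt_eigenvector[OF M this] mat_sqrt_eigenvector[OF M E(2)[OF b]]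
    show "(mat_sqrt M ** N) *v b = (N ** mat_sqrt M) *v b"
      by (simp add: matrix_vector_mult_scaleR flip: matrix_vector_mul_assoc)
  qed
qed

section \<open>Eigenvalues listed with multiplicity\<close>

lemma eig_list_symmetric:
  fixes M :: "real^'m^'m"
  assumes sym: "transpose M = M"
  shows sorted_eig_list: "sorted (eig_list M)"
    and count_eig_list: "count_list (eig_list M) \<mu> = dim {v. M *v v = \<mu> *\<^sub>R v}"
proof -
  define d where "d \<mu> = dim {v. M *v v = \<mu> *s v}" for \<mu>
  define Q where "Q xs \<longleftrightarrow> sorted xs \<and> (\<forall>\<mu>. count_list xs \<mu> = d \<mu>)" for xs
  define eigs where "eigs = {\<mu>. \<exists>v. v \<noteq> 0 \<and> M *v v = \<mu> *\<^sub>R v}"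
  have fin: "finite eigs" unfolding eigs_def by (rule finite_eigenvalues_symmetric[OF sym])
  have d0: "d \<mu> = 0" if "\<mu> \<notin> eigs" for \<mu>
  proof -
    have "{v. M *v v = \<mu> *s v} \<subseteq> {0}"
      using that by (auto simp: eigs_def scalar_mult_eq_scaleR)
    then show ?thesis unfolding d_def by (simp only: dim_eq_0)
  qed
  \<comment> \<open>The prescribed counts form a multiset because only finitely many are nonzero.
    Sorting it gives existence of the list; uniqueness holds because a sorted list is determined by
    its multiset.\<close>
  define A where "A = (\<Sum>\<mu>\<in>eigs. replicate_mset (d \<mu>) \<mu>)"
  have cnt: "count A \<mu> = d \<mu>" for \<mu>
    using fin d0 by (simp add: A_def count_sum)
  have "Q (sorted_list_of_multiset A)"
    by (simp add: Q_def cnt flip: count_mset)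
  moreover have "xs = ys" if "Q xs" "Q ys" for xs ys
  proof -
    have "mset xs = mset ys" using that by (intro multiset_eqI) (simp add: count_mset Q_def)
    then show ?thesis using that properties_for_sort unfolding Q_def by metis
  qed
  ultimately have "\<exists>!xs. Q xs" by blast
  then have "Q (THE xs. Q xs)" by (rule theI')
  then have "Q (eig_list M)" by (simp add: eig_list_def Q_def d_def)
  then show "sorted (eig_list M)" "count_list (eig_list M) \<mu> = dim {v. M *v v = \<mu> *\<^sub>R v}"
    by (auto simp: Q_def d_def scalar_mult_eq_scaleR)
qed

lemma set_eig_list:
  fixes M :: "real^'m^'m"
  assumes sym: "transpose M = M"
  shows "\<mu> \<in> set (eig_list M) \<longleftrightarrow> (\<exists>v. v \<noteq> 0 \<and> M *v v = \<mu> *\<^sub>R v)"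
proof -
  have "\<mu> \<in> set (eig_list M) \<longleftrightarrow> dim {v. M *v v = \<mu> *\<^sub>R v} \<noteq> 0"
    using count_list_0_iff[of "eig_list M" \<mu>] count_eig_list[OF sym, of \<mu>] by simp
  also have "\<dots> \<longleftrightarrow> (\<exists>v. v \<noteq> 0 \<and> M *v v = \<mu> *\<^sub>R v)"
    by (auto simp: dim_eq_0)
  finally show ?thesis .
qed

text \<open>The minimum of the Rayleigh quotient over the whole space is itself an eigenvalue, hence
  at least the head of the sorted list.\<close>

lemma lambda_min_le:
  fixes M :: "real^'m^'m"
  assumes sym: "transpose M = M"
  shows "lambda_min M * (x \<bullet> x) \<le> x \<bullet> (M *v x)"
proof -
  obtain v \<mu> where v: "norm v = 1" "M *v v = \<mu> *\<^sub>R v"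
    and le: "\<And>x. \<mu> * (x \<bullet> x) \<le> x \<bullet> (M *v x)"
    using rayleigh_minimum[OF sym subspace_UNIV, of 1] by auto
  have "\<mu> \<in> set (eig_list M)" using v set_eig_list[OF sym] by (metis norm_zero zero_neq_one)
  then obtain j where "j < length (eig_list M)" "eig_list M ! j = \<mu>"
    by (auto simp: in_set_conv_nth)
  then have "lambda_min M \<le> \<mu>"
    unfolding lambda_min_def using sorted_nth_mono[OF sorted_eig_list[OF sym], of 0 j] by simp
  then show ?thesis using le[of x] mult_right_mono[of _ _ "x \<bullet> x"] by (metis inner_ge_zero order_trans)
qed

text \<open>The vector \<open>z\<close> forces dimension at least two. The Rayleigh minimum
  \<open>\<mu>\<close> over the complement of \<open>e\<close> is a nonzero eigenvalue, since the
  kernel is spanned by \<open>e\<close>; in the list it comes after an entry equal to 0, so the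
  entry at index 1 is at most \<open>\<mu>\<close>.\<close>

lemma lambda2_bounds:
  fixes M :: "real^'m^'m"
  assumes M: "psd M" and ker: "{v. M *v v = 0} = span {e}" and e: "e \<noteq> 0"
    and z: "e \<bullet> z = 0" "z \<noteq> 0"
  shows lambda2_pos: "0 < lambda2 M"
    and lambda2_le: "e \<bullet> x = 0 \<Longrightarrow> lambda2 M * (x \<bullet> x) \<le> x \<bullet> (M *v x)"
proof -
  have sym: "transpose M = M" and pos: "0 \<le> x \<bullet> (M *v x)" for x
    using M by (auto simp: psd_def)
  let ?xs = "eig_list M"
  define S where "S = {x. e \<bullet> x = 0}"
  have S: "subspace S" by (auto simp: S_def subspace_def inner_add_right)
  have Me: "M *v e = 0" using ker span_base[of e "{e}"] by blast
  have inv: "M *v x \<in> S" if "x \<in> S" for x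
    using symmetric_inner[OF sym, of e x] Me by (simp add: S_def)
  have "z \<in> S" using z by (simp add: S_def)
  then obtain v \<mu> where v: "v \<in> S" "norm v = 1" "M *v v = \<mu> *\<^sub>R v"
    and le: "\<And>x. x \<in> S \<Longrightarrow> \<mu> * (x \<bullet> x) \<le> x \<bullet> (M *v x)"
    using rayleigh_minimum[OF sym S inv _ z(2)] by blast
  have "\<mu> \<noteq> 0"
  proof
    assume "\<mu> = 0"
    then have "v \<in> span {e}" using v ker by auto
    then obtain c where "v = c *\<^sub>R e" by (auto simp: span_singleton)
    then have "v \<bullet> v = 0" using v(1) by (simp add: S_def)
    with v(2) show False by simp
  qed
  have "\<mu> \<in> set ?xs" using v set_eig_list[OF sym] by (metis norm_zero zero_neq_one)
  then obtain j where j: "j < length ?xs" "?xs ! j = \<mu>" by (auto simp: in_set_conv_nth)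
  have "0 \<in> set ?xs" using set_eig_list[OF sym] e Me by (metis scaleR_zero_left)
  then obtain i where i: "i < length ?xs" "?xs ! i = 0" by (auto simp: in_set_conv_nth)
  have nonneg: "0 \<le> \<mu>'" if "\<mu>' \<in> set ?xs" for \<mu>'
  proof -
    obtain w where w: "w \<noteq> 0" "M *v w = \<mu>' *\<^sub>R w" using set_eig_list[OF sym] \<open>\<mu>' \<in> set ?xs\<close> by blast
    then show ?thesis using pos[of w] by (auto simp: zero_le_mult_iff dest: leD)
  qed
  have "i < j"
    using i j nonneg[OF \<open>\<mu> \<in> set ?xs\<close>] \<open>\<mu> \<noteq> 0\<close> sorted_nth_mono[OF sorted_eig_list[OF sym], of j i]
    by (cases "i < j") auto
  then have len: "1 < length ?xs" and le\<mu>: "?xs ! 1 \<le> \<mu>"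
    using j sorted_nth_mono[OF sorted_eig_list[OF sym], of 1 j] by auto
  \<comment> \<open>Otherwise the first entry is 0 as well, and the eigenvalue 0 has multiplicity at
    least two, against a one-dimensional kernel.\<close>
  have "?xs ! 1 \<noteq> 0"
  proof
    assume 1: "?xs ! 1 = 0"
    have "0 < length ?xs" using len by linarith
    then have "?xs ! 0 \<in> set ?xs" by (rule nth_mem)
    then have "?xs ! 0 = 0"
      using 1 len nonneg[of "?xs ! 0"] sorted_nth_mono[OF sorted_eig_list[OF sym], of 0 1] by force
    then have "2 \<le> count_list ?xs 0"
      using 1 len by (cases ?xs; cases "tl ?xs") auto
    moreover have "count_list ?xs 0 = dim (span {e})"
      using count_eig_list[OF sym, of 0] ker by simp
    moreover have "dim (span {e}) \<le> 1" using dim_le_card[of "span {e}" "{e}"] by simp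
    ultimately show False by simp
  qed
  with nonneg[of "?xs ! 1"] len show "0 < lambda2 M" by (simp add: lambda2_def order_less_le)
  show "lambda2 M * (x \<bullet> x) \<le> x \<bullet> (M *v x)" if "e \<bullet> x = 0"
    using le[of x] that mult_right_mono[OF le\<mu>, of "x \<bullet> x"] by (simp add: S_def lambda2_def)
qed

section \<open>Spectral radius of symmetric matrices\<close>

lemma symmetric_complex_eigenvalue:
  fixes M :: "real^'m^'m"
  assumes sym: "transpose M = M"
    and z: "z \<in> eigenvals (\<chi> i j. complex_of_real (M $ i $ j))"
  obtains \<mu> v where "z = complex_of_real \<mu>" "v \<noteq> 0" "M *v v = \<mu> *\<^sub>R v"
proof -
  obtain w where w: "w \<noteq> 0" "(\<chi> i j. complex_of_real (M $ i $ j)) *v w = z *s w"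
    using z by (auto simp: eigenvals_def)
  \<comment> \<open>With \<open>a\<close> and \<open>b\<close> the real and imaginary parts of the
    eigenvector, comparing \<open>a . M b\<close> with \<open>M a . b\<close> leaves
    \<open>Im z (a . a + b . b) = 0\<close>.\<close>
  define a b where "a = (\<chi> i. Re (w $ i))" and "b = (\<chi> i. Im (w $ i))"
  have eq: "(\<Sum>j\<in>UNIV. complex_of_real (M $ i $ j) * w $ j) = z * w $ i" for i
    using arg_cong[OF w(2), of "\<lambda>x. x $ i"] by (simp add: matrix_vector_mult_def)
  have Ma: "M *v a = Re z *\<^sub>R a - Im z *\<^sub>R b" and Mb: "M *v b = Re z *\<^sub>R b + Im z *\<^sub>R a"
    using arg_cong[OF eq, of Re] arg_cong[OF eq, of Im]
    by (auto simp: vec_eq_iff a_def b_def matrix_vector_mult_def)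
  have ab: "a \<noteq> 0 \<or> b \<noteq> 0"
    using w(1) by (auto simp: vec_eq_iff a_def b_def complex_eq_iff)
  then have "a \<bullet> a + b \<bullet> b \<noteq> 0"
    by (metis add_nonneg_eq_0_iff inner_eq_zero_iff inner_ge_zero)
  moreover have "Im z * (a \<bullet> a + b \<bullet> b) = 0"
    using symmetric_inner[OF sym, of a b] by (simp add: Ma Mb algebra_simps inner_commute)
  ultimately have "Im z = 0" by simp
  then have "z = complex_of_real (Re z)" by (simp add: complex_eq_iff)
  moreover have "M *v a = Re z *\<^sub>R a" "M *v b = Re z *\<^sub>R b" using Ma Mb \<open>Im z = 0\<close> by auto
  ultimately show ?thesis using ab that by blast
qed

text \<open>Minimising the form of \<open>- M\<close> yields the largest eigenvalue
  \<open>- \<mu>\<close> of \<open>M\<close>, which is at most its modulus and so at most the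
  radius. Its eigenvector is complexified because the radius ranges over complex eigenvalues; these
  form a finite set, so \<open>Max\<close> is meaningful.\<close>

lemma spectral_radius_bound:
  fixes M :: "real^'m^'m"
  assumes sym: "transpose M = M"
  shows "x \<bullet> (M *v x) \<le> spectral_radius M * (x \<bullet> x)"
    and "0 \<le> spectral_radius M"
proof -
  let ?Ev = "eigenvals (\<chi> i j. complex_of_real (M $ i $ j))"
  have "?Ev \<subseteq> complex_of_real ` {\<mu>. \<exists>v. v \<noteq> 0 \<and> M *v v = \<mu> *\<^sub>R v}"
    using symmetric_complex_eigenvalue[OF sym] by blast
  then have fin: "finite ?Ev"
    using finite_eigenvalues_symmetric[OF sym] finite_surj by blast
  have minus: "(- M) *v y = - (M *v y)" for y
    by (simp add: matrix_vector_mult_def vec_eq_iff sum_negf)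
  have "transpose (- M) = - M" using sym by (simp add: transpose_def vec_eq_iff)
  then obtain v \<mu> where v: "norm v = 1" "(- M) *v v = \<mu> *\<^sub>R v"
    and le: "\<And>x. \<mu> * (x \<bullet> x) \<le> x \<bullet> ((- M) *v x)"
    using rayleigh_minimum[OF _ subspace_UNIV, of "- M" 1] by auto
  have Mv: "M *v v = - \<mu> *\<^sub>R v" using v(2) by (simp add: minus neg_eq_iff_add_eq_0 add_eq_0_iff)
  define w where "w = (\<chi> i. complex_of_real (v $ i))"
  have "v \<noteq> 0" using v(1) by auto
  then have "w \<noteq> 0" by (simp add: w_def vec_eq_iff)
  moreover have "(\<chi> i j. complex_of_real (M $ i $ j)) *v w = complex_of_real (- \<mu>) *s w"
  proof -
    have "(\<Sum>j\<in>UNIV. M $ i $ j * v $ j) = - \<mu> * v $ i" for i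
      using arg_cong[OF Mv, of "\<lambda>x. x $ i"] by (simp add: matrix_vector_mult_def)
    from arg_cong[OF this, of complex_of_real] show ?thesis
      by (simp add: matrix_vector_mult_def w_def vec_eq_iff)
  qed
  ultimately have "complex_of_real (- \<mu>) \<in> ?Ev" by (auto simp: eigenvals_def)
  then have "cmod (complex_of_real (- \<mu>)) \<le> spectral_radius M"
    unfolding spectral_radius_def using fin by (intro Max_ge) blast+
  then have \<mu>: "- \<mu> \<le> spectral_radius M" and "0 \<le> spectral_radius M" by auto
  then show "0 \<le> spectral_radius M" by simp
  have "x \<bullet> (M *v x) \<le> - \<mu> * (x \<bullet> x)" using le[of x] by (simp add: minus)
  also have "\<dots> \<le> spectral_radius M * (x \<bullet> x)" using \<mu> by (intro mult_right_mono) auto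
  finally show "x \<bullet> (M *v x) \<le> spectral_radius M * (x \<bullet> x)" .
qed

subsection \<open>Matrices acting on stacked vectors\<close>

lemma linear_matrix_mult: "linear (\<lambda>X :: real^'d^'m. (M :: real^'m^'n) ** X)"
  by (auto simp: linear_iff matrix_matrix_mult_def vec_eq_iff sum.distrib sum_distrib_left algebra_simps)

lemma matrix_mult_diff_left: "(M - N :: real^'m^'n) ** X = M ** X - N ** X"
  by (simp add: matrix_matrix_mult_def vec_eq_iff left_diff_distrib sum_subtractf)

lemma matrix_mult_scaleR_left: "(c *\<^sub>R M :: real^'m^'n) ** X = c *\<^sub>R (M ** X)"
  by (simp add: matrix_matrix_mult_def vec_eq_iff sum_distrib_left mult.assoc)

lemma column_matrix_mult: "column j ((M :: real^'m^'n) ** X) = M *v column j X"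
  by (simp add: column_def matrix_matrix_mult_def matrix_vector_mult_def vec_eq_iff)

text \<open>Left multiplication acts on each column separately, so this reduces quadratic-form
  inequalities for stacked iterates to the vector case.\<close>

lemma inner_eq_sum_columns:
  fixes X Y :: "real^'d^'m"
  shows "X \<bullet> Y = (\<Sum>j\<in>UNIV. column j X \<bullet> column j Y)"
  by (simp add: inner_vec_def column_def) (rule sum.swap)

lemma symmetric_matrix_inner:
  fixes M :: "real^'m^'m" and X Y :: "real^'d^'m"
  assumes "transpose M = M"
  shows "X \<bullet> (M ** Y) = (M ** X) \<bullet> Y"
  by (simp add: inner_eq_sum_columns column_matrix_mult symmetric_inner[OF assms])

lemma psd_matrix_inner:
  fixes M :: "real^'m^'m" and X :: "real^'d^'m"
  assumes "psd M"
  shows "0 \<le> X \<bullet> (M ** X)"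
  using assms unfolding inner_eq_sum_columns column_matrix_mult psd_def by (intro sum_nonneg) auto

lemma lambda_min_matrix_inner:
  fixes M :: "real^'m^'m" and X :: "real^'d^'m"
  assumes "transpose M = M"
  shows "lambda_min M * (X \<bullet> X) \<le> X \<bullet> (M ** X)"
  unfolding inner_eq_sum_columns column_matrix_mult sum_distrib_left
  by (intro sum_mono lambda_min_le assms)

lemma trace_transpose_mult:
  fixes X Y :: "real^'d^'m"
  shows "trace (transpose X ** Y) = X \<bullet> Y"
  by (simp add: trace_def transpose_def matrix_matrix_mult_def inner_vec_def) (rule sum.swap)

lemma wnorm_sq_eq_inner: "wnorm_sq D X = X \<bullet> (D ** X)"
  by (simp add: wnorm_sq_def trace_transpose_mult flip: matrix_mul_assoc)

lemma matrix_mult_consensus: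
  fixes M :: "real^'m^'m"
  assumes "M *v 1 = c *\<^sub>R 1"
  shows "M ** consensus x = c *\<^sub>R consensus x"
proof -
  have "(\<Sum>j\<in>UNIV. M $ i $ j) = c" for i
    using arg_cong[OF assms, of "\<lambda>v. v $ i"] by (simp add: matrix_vector_mult_def)
  then show ?thesis
    by (simp add: consensus_def matrix_matrix_mult_def vec_eq_iff flip: sum_distrib_right)
qed

lemma inner_consensus: "consensus x \<bullet> Y = x \<bullet> (\<Sum>i\<in>UNIV. Y $ i)"
  by (simp add: consensus_def inner_vec_def[of _ Y] inner_sum_right)

lemma avg_mat_mult_vector: "(avg_mat :: real^'m^'m) *v x = ((1 \<bullet> x) / real CARD('m)) *\<^sub>R 1"
  by (simp add: avg_mat_def matrix_vector_mult_def vec_eq_iff inner_vec_def sum_divide_distrib)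

lemma transpose_avg_mat: "transpose avg_mat = avg_mat"
  by (simp add: avg_mat_def transpose_def)

lemma avg_mat_complement_orthogonal: "1 \<bullet> ((mat 1 - avg_mat :: real^'m^'m) *v x) = 0"
proof -
  have "(1 :: real^'m) \<bullet> 1 = real CARD('m)" by (simp add: inner_vec_def)
  then show ?thesis
    by (simp add: matrix_vector_mult_diff_rdistrib avg_mat_mult_vector inner_diff_right)
qed

lemma avg_mat_mult_eq_0:
  fixes G :: "real^'d^'m"
  assumes "(\<Sum>i\<in>UNIV. G $ i) = 0"
  shows "avg_mat ** G = 0"
proof -
  have "(\<Sum>i\<in>UNIV. G $ i $ j) = 0" for j
    using arg_cong[OF assms, of "\<lambda>v. v $ j"] by (simp add: sum_component)
  then show ?thesis
    by (simp add: avg_mat_def matrix_matrix_mult_def vec_eq_iff flip: sum_divide_distrib)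
qed

subsection \<open>Smooth convex functions\<close>

lemma smooth_GDERIV:
  fixes f :: "real^'d \<Rightarrow> real"
  assumes "smooth L f"
  shows "GDERIV f x :> grad f x"
proof -
  obtain F where F: "(f has_derivative F) (at x)"
    using assms by (auto simp: smooth_def differentiable_def)
  then have lin: "linear F" by (rule has_derivative_linear)
  \<comment> \<open>\<open>adjoint F 1\<close> is the Riesz representative of the functional
    \<open>F\<close>; the uniqueness shown below makes the \<open>THE\<close> in \<open>grad\<close>
    select it.\<close>
  have "F = (\<lambda>h. h \<bullet> adjoint F 1)"
    using adjoint_works[OF lin, of _ 1] by auto
  with F have "GDERIV f x :> adjoint F 1" unfolding gderiv_def by simp
  moreover have "g = g'" if "GDERIV f x :> g" "GDERIV f x :> g'" for g g'
  proof -
    have "(\<lambda>h. h \<bullet> g) = (\<lambda>h. h \<bullet> g')"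
      using that unfolding gderiv_def by (rule has_derivative_unique)
    then show ?thesis using vector_eq_ldot by metis
  qed
  ultimately show ?thesis unfolding grad_def by (metis theI')
qed

lemma smooth_along_line:
  fixes f :: "real^'d \<Rightarrow> real"
  assumes "smooth L f"
  shows "((\<lambda>t. f (x + t *\<^sub>R d)) has_real_derivative d \<bullet> grad f (x + t *\<^sub>R d)) (at t within S)"
proof -
  have "(f has_derivative (\<lambda>h. h \<bullet> grad f (x + t *\<^sub>R d))) (at (x + t *\<^sub>R d))"
    using smooth_GDERIV[OF assms] unfolding gderiv_def .
  moreover have "((\<lambda>t. x + t *\<^sub>R d) has_derivative (\<lambda>h. h *\<^sub>R d)) (at t within S)"
    by (auto intro!: derivative_eq_intros)
  ultimately have "((\<lambda>t. f (x + t *\<^sub>R d)) has_derivative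
      (\<lambda>h. (h *\<^sub>R d) \<bullet> grad f (x + t *\<^sub>R d))) (at t within S)"
    by (rule has_derivative_compose[rotated])
  then show ?thesis by (simp add: has_field_derivative_def mult_commute_abs)
qed

text \<open>Descent lemma: on the segment, subtracting the linear and quadratic terms leaves
  \<open>\<phi>\<close>, whose derivative is nonpositive by Cauchy-Schwarz and the Lipschitz
  gradient; then \<open>\<phi> 1\<close> is compared with \<open>\<phi> 0\<close>.\<close>

lemma smooth_upper_bound:
  fixes f :: "real^'d \<Rightarrow> real"
  assumes sm: "smooth L f"
  shows "f y \<le> f x + grad f x \<bullet> (y - x) + L / 2 * ((y - x) \<bullet> (y - x))"
proof -
  define d where "d = y - x"
  define \<phi> where "\<phi> t = f (x + t *\<^sub>R d) - t * (d \<bullet> grad f x) - L / 2 * t\<^sup>2 * (d \<bullet> d)" for t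
  have "\<phi> 1 \<le> \<phi> 0"
  proof (rule DERIV_nonpos_imp_nonincreasing, simp, intro exI conjI)
    fix t :: real assume t: "0 \<le> t"
    show "DERIV \<phi> t :> d \<bullet> grad f (x + t *\<^sub>R d) - d \<bullet> grad f x - L * t * (d \<bullet> d)"
      unfolding \<phi>_def by (rule derivative_eq_intros smooth_along_line[OF sm] refl | simp)+
    have "d \<bullet> (grad f (x + t *\<^sub>R d) - grad f x) \<le> norm d * norm (grad f (x + t *\<^sub>R d) - grad f x)"
      by (rule norm_cauchy_schwarz)
    also have "norm (grad f (x + t *\<^sub>R d) - grad f x) \<le> L * (t * norm d)"
      using lipschitz_onD[of L UNIV "grad f" "x + t *\<^sub>R d" x] sm t
      by (simp add: smooth_def dist_norm)
    finally have "d \<bullet> (grad f (x + t *\<^sub>R d) - grad f x) \<le> norm d * (L * (t * norm d))"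
      by (simp add: mult_left_mono)
    also have "\<dots> = L * t * (d \<bullet> d)" by (simp add: dot_square_norm power2_eq_square)
    finally show "d \<bullet> grad f (x + t *\<^sub>R d) - d \<bullet> grad f x - L * t * (d \<bullet> d) \<le> 0"
      by (simp add: inner_diff_right)
  qed
  then show ?thesis by (simp add: \<phi>_def d_def inner_commute)
qed

text \<open>Restricted to the line through \<open>x\<close> and \<open>y\<close>, the function is
  convex in one real variable and lies above its tangent at 0.\<close>

lemma smooth_convex_lower_bound:
  fixes f :: "real^'d \<Rightarrow> real"
  assumes sm: "smooth L f" and cv: "convex_on UNIV f"
  shows "f x + grad f x \<bullet> (y - x) \<le> f y"
proof -
  define \<phi> where "\<phi> t = f (x + t *\<^sub>R (y - x))" for t
  have "convex_on UNIV \<phi>"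
  proof (rule convex_onI)
    fix t a b :: real assume t: "0 < t" "t < 1"
    have "\<phi> ((1 - t) *\<^sub>R a + t *\<^sub>R b)
        = f ((1 - t) *\<^sub>R (x + a *\<^sub>R (y - x)) + t *\<^sub>R (x + b *\<^sub>R (y - x)))"
      unfolding \<phi>_def by (rule arg_cong[of _ _ f]) (simp add: algebra_simps)
    also have "\<dots> \<le> (1 - t) * \<phi> a + t * \<phi> b"
      unfolding \<phi>_def using convex_onD[OF cv, of t] t by simp
    finally show "\<phi> ((1 - t) *\<^sub>R a + t *\<^sub>R b) \<le> (1 - t) * \<phi> a + t * \<phi> b" .
  qed simp
  moreover have "(\<phi> has_real_derivative (y - x) \<bullet> grad f x) (at 0 within UNIV)"
    using smooth_along_line[OF sm, of x "y - x" 0 UNIV] unfolding \<phi>_def by simp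
  ultimately have "\<phi> 1 - \<phi> 0 \<ge> ((y - x) \<bullet> grad f x) * (1 - 0)"
    by (intro convex_on_imp_above_tangent[of UNIV]) auto
  then show ?thesis by (simp add: \<phi>_def inner_commute)
qed

text \<open>Both estimates are linearised at \<open>X\<close>: smoothness bounds the value at
  \<open>Y\<close> from above, convexity bounds the value at \<open>Z\<close> from below, and the
  value at \<open>X\<close> cancels. In the iteration these points are the current iterate, the next
  iterate and the optimum.\<close>

lemma total_fun_descent:
  assumes sm: "\<And>i. smooth L (f i)" and cv: "\<And>i. convex_on UNIV (f i)"
  shows "total_fun f Y - total_fun f Z
    \<le> stacked_grad f X \<bullet> (Y - Z) + L / 2 * ((Y - X) \<bullet> (Y - X))"
proof -
  have "f i (Y $ i) - f i (Z $ i)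
      \<le> grad (f i) (X $ i) \<bullet> (Y $ i - Z $ i) + L / 2 * ((Y $ i - X $ i) \<bullet> (Y $ i - X $ i))" for i
    using smooth_upper_bound[OF sm, of i "Y $ i" "X $ i"]
      smooth_convex_lower_bound[OF sm cv, of i "X $ i" "Z $ i"]
    by (simp add: inner_diff_right)
  from sum_mono[of UNIV, OF this] show ?thesis
    by (simp add: total_fun_def stacked_grad_def inner_vec_def[of _ "_ - _ :: real^_^_"]
        sum_subtractf sum.distrib sum_distrib_left)
qed

lemma total_fun_lower_bound:
  assumes sm: "\<And>i. smooth L (f i)" and cv: "\<And>i. convex_on UNIV (f i)"
  shows "total_fun f Z + stacked_grad f Z \<bullet> (Y - Z) \<le> total_fun f Y"
proof -
  have "f i (Z $ i) + grad (f i) (Z $ i) \<bullet> (Y $ i - Z $ i) \<le> f i (Y $ i)" for i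
    using smooth_convex_lower_bound[OF sm cv] .
  from sum_mono[of UNIV, OF this] show ?thesis
    by (simp add: total_fun_def stacked_grad_def inner_vec_def[of _ "_ - _ :: real^_^_"] sum.distrib)
qed

lemma total_fun_average:
  assumes cv: "\<And>i. convex_on UNIV (f i)" and k: "k \<ge> 1"
  shows "total_fun f ((1 / real k) *\<^sub>R (\<Sum>t=1..k. X t)) \<le> 1 / real k * (\<Sum>t=1..k. total_fun f (X t))"
proof -
  have "f i (\<Sum>t\<in>{1..k}. (1 / real k) *\<^sub>R (X t $ i)) \<le> (\<Sum>t\<in>{1..k}. 1 / real k * f i (X t $ i))" for i
    using k by (intro convex_on_sum[OF _ _ cv]) auto
  from sum_mono[of UNIV, OF this]
  have "total_fun f ((1 / real k) *\<^sub>R (\<Sum>t=1..k. X t))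
      \<le> (\<Sum>i\<in>UNIV. \<Sum>t\<in>{1..k}. 1 / real k * f i (X t $ i))"
    by (simp add: total_fun_def scaleR_sum_right)
  also have "\<dots> = (\<Sum>t\<in>{1..k}. \<Sum>i\<in>UNIV. 1 / real k * f i (X t $ i))" by (rule sum.swap)
  finally show ?thesis by (simp add: total_fun_def sum_distrib_left)
qed

lemma sum_stacked_grad_minimizer:
  assumes sm: "\<And>i. smooth L (f i)" and opt: "\<And>x. (\<Sum>i\<in>UNIV. f i xs) \<le> (\<Sum>i\<in>UNIV. f i x)"
  shows "(\<Sum>i\<in>UNIV. stacked_grad f (consensus xs) $ i) = 0"
proof -
  have "((\<lambda>x. \<Sum>i\<in>UNIV. f i x) has_derivative (\<lambda>h. \<Sum>i\<in>UNIV. h \<bullet> grad (f i) xs)) (at xs)"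
    using smooth_GDERIV[OF sm] unfolding gderiv_def by (intro has_derivative_sum)
  then have "(\<lambda>h. \<Sum>i\<in>UNIV. h \<bullet> grad (f i) xs) = (\<lambda>h. 0)"
    using differential_zero_maxmin[OF UNIV_I open_UNIV] opt by blast
  then have "h \<bullet> (\<Sum>i\<in>UNIV. grad (f i) xs) = h \<bullet> 0" for h
    by (simp add: inner_sum_right fun_eq_iff)
  then have "(\<Sum>i\<in>UNIV. grad (f i) xs) = 0" using vector_eq_ldot by blast
  then show ?thesis by (simp add: stacked_grad_def consensus_def)
qed

subsection \<open>Convergence of the primal-dual iteration\<close>

text \<open>After eliminating \<open>g\<close> and expanding all inner products, the right side
  minus the left side is exactly the form in \<open>nonneg\<close> at \<open>u = R w\<close>. The
  quadratic term kept on the left later absorbs the smoothness error.\<close>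

lemma primal_dual_step:
  fixes D R C :: "'a::real_inner \<Rightarrow> 'a"
  assumes lin: "linear D" "linear R" "linear C"
    and symD: "\<And>x y. x \<bullet> D y = D x \<bullet> y" and symR: "\<And>x y. x \<bullet> R y = R x \<bullet> y"
    and symC: "\<And>x y. x \<bullet> C y = C x \<bullet> y"
    and comm: "\<And>x. R (C x) = C (R x)"
    and nonneg: "\<And>u. 0 \<le> u \<bullet> u - 1 / 2 * (u \<bullet> C u) - u \<bullet> R (D (R u))"
    and z: "D z = z" "R z = z" "C z = 0"
    and w: "w = D x - g - C s" and x': "x' = R (R w)"
  shows "g \<bullet> (x' - z) + 1 / 2 * ((x' - x) \<bullet> D (x' - x))
    \<le> 1 / 2 * ((x - z) \<bullet> D (x - z) - (x' - z) \<bullet> D (x' - z))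
      + 1 / 2 * (R s \<bullet> C (R s) - R (s + w) \<bullet> C (R (s + w)))"
proof -
  define u where "u = R w"
  define T where "T = R s"
  have g: "g = D x - C s - w" using w by simp
  have energy: "(y - z) \<bullet> D (y - z) = y \<bullet> D y - 2 * (y \<bullet> z) + z \<bullet> z" for y
    using symD[of z y] z
    by (simp add: linear_diff[OF lin(1)] inner_diff_left inner_diff_right inner_commute)
  have "D x \<bullet> z = x \<bullet> z" using symD[of x z] z by simp
  moreover have "C s \<bullet> z = 0" using symC[of s z] z by simp
  \<comment> \<open>Since \<open>R z = z\<close>, both factors \<open>R\<close> can be moved onto
    \<open>z\<close> and disappear. In the next two lines the same move turns pairings with
    \<open>x'\<close> into pairings with \<open>u\<close>.\<close>
  moreover have "w \<bullet> z = x' \<bullet> z" using symR[of w z] symR[of "R w" z] z x' by simp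
  moreover have "w \<bullet> x' = u \<bullet> u" using symR[of w "R w"] x' by (simp add: u_def)
  moreover have "C s \<bullet> x' = T \<bullet> C u"
    using symR[of "C s" "R w"] symC[of T u] x' by (simp add: u_def T_def comm)
  ultimately have "g \<bullet> (x' - z) = x \<bullet> D x' - x \<bullet> z - T \<bullet> C u - u \<bullet> u + x' \<bullet> z"
    using symD[of x x'] unfolding g by (simp add: inner_diff_left inner_diff_right)
  moreover have "(x' - x) \<bullet> D (x' - x) = x' \<bullet> D x' - 2 * (x \<bullet> D x') + x \<bullet> D x"
    using symD[of x x'] by (simp add: linear_diff[OF lin(1)] inner_diff_left inner_diff_right inner_commute)
  moreover have "R (s + w) \<bullet> C (R (s + w)) = T \<bullet> C T + 2 * (T \<bullet> C u) + u \<bullet> C u"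
    using symC[of T u]
    by (simp add: linear_add[OF lin(2)] linear_add[OF lin(3)] T_def u_def inner_add_left inner_add_right inner_commute)
  moreover have "x' \<bullet> D x' = u \<bullet> R (D (R u))"
    using symR[of u "D (R u)"] x' by (simp add: u_def)
  moreover note nonneg[of u] energy[of x] energy[of x']
  ultimately show ?thesis unfolding T_def[symmetric] by (simp add: field_simps)
qed

text \<open>Here \<open>\<Delta>\<close> is the gap in function value, \<open>e\<close> the
  consensus error, \<open>p\<close> the gradient norm at the optimum and \<open>\<tau>\<close> the
  dual energy. The lower bound on \<open>\<Delta>\<close> turns \<open>upper\<close> into a bound on
  \<open>\<tau>\<close> in terms of \<open>y = k e p\<close>, while \<open>y^2\<close> is at most a
  multiple of \<open>\<tau>\<close>; together \<open>y^2 \<le> b (a + y)\<close>.\<close>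

lemma merit_bound_from_energy:
  fixes a \<Delta> e p c \<tau> \<gamma> :: real
  assumes k: "0 < k" and \<gamma>: "0 < \<gamma>" and nonneg: "0 \<le> a" "0 \<le> e" "0 \<le> p" "0 \<le> c"
    and upper: "k * \<Delta> \<le> a - \<tau> / (2 * \<gamma>)" and lower: "- (p * e) \<le> \<Delta>" and \<tau>: "0 \<le> \<tau>"
    and e: "(k * e * p)\<^sup>2 \<le> c * p\<^sup>2 * \<tau>"
  shows "max (e * p) \<bar>\<Delta>\<bar> \<le> 1 / k * (a + 2 * \<gamma> * c * p\<^sup>2)"
proof -
  define y where "y = k * e * p"
  define b where "b = 2 * \<gamma> * c * p\<^sup>2"
  have y: "0 \<le> y" and b: "0 \<le> b" using assms by (auto simp: y_def b_def)
  have "k * \<Delta> \<ge> - y" using mult_left_mono[OF lower, of k] k by (simp add: y_def algebra_simps)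
  then have "\<tau> / (2 * \<gamma>) \<le> a + y" using upper by linarith
  then have "\<tau> \<le> 2 * \<gamma> * (a + y)" using \<gamma> by (simp add: field_simps)
  then have "c * p\<^sup>2 * \<tau> \<le> c * p\<^sup>2 * (2 * \<gamma> * (a + y))"
    using nonneg by (intro mult_left_mono) auto
  then have quad: "y * y \<le> b * (a + y)"
    using e by (simp add: y_def b_def power2_eq_square mult_ac)
  \<comment> \<open>If \<open>y > a + b\<close>, then
    \<open>y^2 > y a + y b \<ge> b a + b y\<close>, against \<open>quad\<close>.\<close>
  have yb: "y \<le> a + b"
  proof (rule ccontr)
    assume "\<not> y \<le> a + b"
    then have "y > a + b" by simp
    then have "y * (a + b) < y * y" using nonneg(1) b by (intro mult_strict_left_mono) auto
    moreover have "b * a \<le> y * a" using \<open>y > a + b\<close> nonneg(1) by (intro mult_right_mono) auto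
    ultimately show False using quad by (simp add: algebra_simps)
  qed
  have "k * (e * p) \<le> a + b" using yb by (simp add: y_def mult_ac)
  \<comment> \<open>A nonnegative gap is at most \<open>a / k\<close> by \<open>upper\<close>; a
    negative one is at least \<open>- y / k\<close>, which the bound on \<open>y\<close>
    covers.\<close>
  moreover have "k * \<bar>\<Delta>\<bar> \<le> a + b"
  proof -
    have "0 \<le> \<tau> / (2 * \<gamma>)" using \<tau> \<gamma> by simp
    then show ?thesis using \<open>k * \<Delta> \<ge> - y\<close> yb upper b k by (auto simp: abs_if)
  qed
  ultimately show ?thesis using k by (auto simp: b_def field_simps)
qed

text \<open>\<open>R\<close> fixes the all-ones vector, so removing the mean commutes with
  \<open>R\<close> and leaves \<open>R u\<close> with \<open>u\<close> of mean zero. On such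
  \<open>u\<close> the forms of \<open>B\<close> and \<open>B - avg_mat\<close> agree, the radius
  bounds the latter, and \<open>lambda2\<close> trades the norm of \<open>u\<close> for the form of
  \<open>C\<close>, which ignores the mean of \<open>t\<close>.\<close>

lemma consensus_error_le:
  fixes B C R :: "real^'m^'m" and z t :: "real^'m"
  assumes symB: "transpose B = B" and R: "psd R" "R ** R = B" "R *v 1 = 1"
    and C: "psd C" "{v. C *v v = 0} = span {1}" and z: "1 \<bullet> z = 0" "z \<noteq> 0"
  shows "(norm ((mat 1 - avg_mat) *v (R *v t)))\<^sup>2
    \<le> spectral_radius (B - avg_mat) / lambda2 C * (t \<bullet> (C *v t))"
proof -
  define \<alpha> where "\<alpha> = (1 \<bullet> t) / real CARD('m)"
  define u where "u = t - \<alpha> *\<^sub>R 1"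
  have symR: "transpose R = R" and symC: "transpose C = C" using R C by (auto simp: psd_def)
  have C1: "C *v 1 = 0" using C(2) span_base[of 1 "{1}"] by blast
  have u: "u = (mat 1 - avg_mat) *v t"
    by (simp add: u_def \<alpha>_def matrix_vector_mult_diff_rdistrib avg_mat_mult_vector)
  then have u1: "1 \<bullet> u = 0" by (simp add: avg_mat_complement_orthogonal)
  have "1 \<bullet> (R *v t) = 1 \<bullet> t" using symmetric_inner[OF symR, of 1 t] R(3) by simp
  then have "(mat 1 - avg_mat) *v (R *v t) = R *v u"
    by (simp add: u_def \<alpha>_def matrix_vector_mult_diff_rdistrib avg_mat_mult_vector
        matrix_vector_mult_diff_distrib matrix_vector_mult_scaleR R(3))
  then have "(norm ((mat 1 - avg_mat) *v (R *v t)))\<^sup>2 = u \<bullet> (B *v u)"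
    using symmetric_inner[OF symR, of u "R *v u"] R(2)
    by (simp add: power2_norm_eq_inner matrix_vector_mul_assoc)
  also have "\<dots> = u \<bullet> ((B - avg_mat) *v u)"
    by (simp add: matrix_vector_mult_diff_rdistrib avg_mat_mult_vector u1)
  also have "\<dots> \<le> spectral_radius (B - avg_mat) * (u \<bullet> u)"
  proof (rule spectral_radius_bound)
    show "transpose (B - avg_mat) = B - avg_mat"
      using symB by (simp add: transpose_def avg_mat_def vec_eq_iff)
  qed
  also have "\<dots> \<le> spectral_radius (B - avg_mat) * ((u \<bullet> (C *v u)) / lambda2 C)"
  proof (rule mult_left_mono)
    show "u \<bullet> u \<le> (u \<bullet> (C *v u)) / lambda2 C"
      using lambda2_le[OF C _ z u1] lambda2_pos[OF C _ z] by (simp add: pos_le_divide_eq mult.commute)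
    show "0 \<le> spectral_radius (B - avg_mat)"
      using symB by (intro spectral_radius_bound(2)) (simp add: transpose_def avg_mat_def vec_eq_iff)
  qed
  also have "u \<bullet> (C *v u) = t \<bullet> (C *v t)"
    using symmetric_inner[OF symC, of 1 t] C1
    by (simp add: u_def matrix_vector_mult_diff_distrib matrix_vector_mult_scaleR inner_diff_left)
  finally show ?thesis by simp
qed

theorem theorem24:
  fixes f :: "'m::finite \<Rightarrow> real^'d \<Rightarrow> real"
    and L \<gamma> :: real
    and xs :: "real^'d"
    and A B C D :: "real^'m^'m"
    and X Y :: "nat \<Rightarrow> real^'d^'m"
    and k :: nat
  assumes "\<And>i. convex_on UNIV (f i)"
    and "\<And>i. smooth L (f i)"
    and "\<And>x. 1 / real CARD('m) * (\<Sum>i\<in>UNIV. f i xs) \<le> 1 / real CARD('m) * (\<Sum>i\<in>UNIV. f i x)"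
    and "transpose B = B" and "transpose C = C" and "transpose D = D"
    and "A = B ** D" and "loewner_le 0 B" and "loewner_less 0 D"
    and "D *v 1 = 1" and "1 v* B = 1"
    and "loewner_le 0 C" and "{v. C *v v = 0} = span {1}"
    and "B ** C = C ** B"
    and "loewner_le 0 (mat 1 - (1/2) *\<^sub>R C - mat_sqrt B ** D ** mat_sqrt B)"
    and "Y 0 = 0"
    and "\<And>n. X (Suc n) = A ** X n - \<gamma> *\<^sub>R (B ** stacked_grad f (X n)) - Y n"
    and "\<And>n. Y (Suc n) = Y n + C ** X (Suc n)"
    and "0 < \<gamma>" and "\<gamma> \<le> lambda_min D / L"
    and "k \<ge> 1"
  shows "merit f (consensus xs) ((1 / real k) *\<^sub>R (\<Sum>t=1..k. X t))
    \<le> 1 / real k *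
        (1 / (2 * \<gamma>) * wnorm_sq D (X 0 - consensus xs)
         + 2 * \<gamma> * (spectral_radius (B - avg_mat) / lambda2 C)
             * (norm (stacked_grad f (consensus xs)))\<^sup>2)"
proof -
  note cv = assms(1) and sm = assms(2) and symB = assms(4) and symC = assms(5) and symD = assms(6)
    and A = assms(7) and D1 = assms(10) and kerC = assms(13) and comm = assms(14)
    and Y0 = assms(16) and Xrec = assms(17) and Yrec = assms(18) and \<gamma> = assms(19) and k = assms(21)
  define R where "R = mat_sqrt B"
  define Z :: "real^'d^'m" where "Z = consensus xs"
  define G where "G = stacked_grad f"
  have psdB: "psd B" and psdC: "psd C" using assms(8,12) by (simp_all add: loewner_le_def)
  have psdR: "psd R" and RR: "R ** R = B" and RC: "R ** C = C ** R"
    using psd_mat_sqrt[OF psdB] mat_sqrt_square[OF psdB] mat_sqrt_commute[OF psdB comm]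
    by (simp_all add: R_def)
  have symR: "transpose R = R" using psdR by (simp add: psd_def)
  have B1: "B *v 1 = 1" using assms(11) symB by (metis transpose_matrix_vector)
  have R1: "R *v 1 = 1" using mat_sqrt_eigenvector[OF psdB, of 1 1] B1 by (simp add: R_def)
  have C1: "C *v 1 = 0" using kerC span_base[of 1 "{1}"] by blast
  have RRX: "R ** (R ** X) = B ** X" for X :: "real^'d^'m" by (simp add: matrix_mul_assoc RR)

  \<comment> \<open>\<open>W n\<close> depends on \<open>S n\<close>, so the running sum is defined
    by recursion with the summand written out.\<close>
  define S :: "nat \<Rightarrow> real^'d^'m"
    where "S = rec_nat 0 (\<lambda>n s. s + (D ** X n - \<gamma> *\<^sub>R G (X n) - C ** s))"
  define W where "W n = D ** X n - \<gamma> *\<^sub>R G (X n) - C ** S n" for n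
  have S0: "S 0 = 0" and Srec: "S (Suc n) = S n + W n" for n by (simp_all add: S_def W_def)
  \<comment> \<open>\<open>A = B D\<close> pulls the factor \<open>B\<close> out of the primal
    update; commutation of \<open>B\<close> and \<open>C\<close> pulls it out of the increment
    \<open>C X\<close> of the dual update.\<close>
  have XY: "Y n = B ** (C ** S n) \<and> X (Suc n) = B ** W n" for n
  proof (induction n)
    case 0
    show ?case
      by (simp add: Xrec Y0 S0 W_def A G_def linear_0[OF linear_matrix_mult]
          linear_diff[OF linear_matrix_mult] linear_scale[OF linear_matrix_mult] flip: matrix_mul_assoc)
  next
    case (Suc n)
    have CB: "C ** (B ** V) = B ** (C ** V)" for V :: "real^'d^'m"
      by (simp add: matrix_mul_assoc comm)
    have "Y (Suc n) = B ** (C ** S (Suc n))"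
      using Suc by (simp add: Yrec CB Srec linear_add[OF linear_matrix_mult])
    then show ?case
      by (simp add: Xrec[of "Suc n"] W_def[of "Suc n"] A G_def
          linear_diff[OF linear_matrix_mult] linear_scale[OF linear_matrix_mult] flip: matrix_mul_assoc)
  qed

  define P where "P n = wnorm_sq D (X n - Z)" for n
  define Q where "Q n = (R ** S n) \<bullet> (C ** (R ** S n))" for n
  have L: "0 < L"
  proof -
    have "0 \<le> L" using sm lipschitz_on_nonneg unfolding smooth_def by blast
    \<comment> \<open>Division by zero yields 0, so \<open>L = 0\<close> would make the upper bound
      on the step size 0, against \<open>0 < \<gamma>\<close>.\<close>
    moreover have "L \<noteq> 0" using assms(19,20) by auto
    ultimately show ?thesis by simp
  qed
  \<comment> \<open>The step size condition enters here: the smoothness error of one step is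
    dominated by its squared \<open>D\<close>-norm.\<close>
  have \<gamma>L: "\<gamma> * L * (V \<bullet> V) \<le> V \<bullet> (D ** V)" for V :: "real^'d^'m"
  proof -
    have "\<gamma> * L \<le> lambda_min D" using assms(20) L by (simp add: pos_le_divide_eq)
    then have "\<gamma> * L * (V \<bullet> V) \<le> lambda_min D * (V \<bullet> V)" by (intro mult_right_mono) auto
    then show ?thesis using lambda_min_matrix_inner[OF symD, of V] by linarith
  qed
  have psdM: "psd (mat 1 - (1/2) *\<^sub>R C - R ** D ** R)"
    using assms(15) by (simp add: loewner_le_def R_def)
  have Mnonneg: "0 \<le> U \<bullet> U - 1 / 2 * (U \<bullet> (C ** U)) - U \<bullet> (R ** (D ** (R ** U)))" for U :: "real^'d^'m"
    using psd_matrix_inner[OF psdM, of U]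
    by (simp add: matrix_mult_diff_left matrix_mult_scaleR_left inner_diff_right flip: matrix_mul_assoc)
  have fixZ: "D ** Z = Z" "R ** Z = Z" "C ** Z = 0"
    using matrix_mult_consensus[of D 1 xs] matrix_mult_consensus[of R 1 xs]
      matrix_mult_consensus[of C 0 xs] D1 R1 C1 by (simp_all add: Z_def)
  have step: "\<gamma> * (total_fun f (X (Suc n)) - total_fun f Z)
      \<le> 1 / 2 * (P n - P (Suc n)) + 1 / 2 * (Q n - Q (Suc n))" for n
  proof -
    have "\<gamma> * (total_fun f (X (Suc n)) - total_fun f Z)
        \<le> \<gamma> * (G (X n) \<bullet> (X (Suc n) - Z) + L / 2 * ((X (Suc n) - X n) \<bullet> (X (Suc n) - X n)))"
      using total_fun_descent[OF sm cv] \<gamma> unfolding G_def by (intro mult_left_mono) auto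
    also have "\<dots> = (\<gamma> *\<^sub>R G (X n)) \<bullet> (X (Suc n) - Z)
        + 1 / 2 * (\<gamma> * L * ((X (Suc n) - X n) \<bullet> (X (Suc n) - X n)))"
      by (simp add: algebra_simps)
    also have "\<dots> \<le> (\<gamma> *\<^sub>R G (X n)) \<bullet> (X (Suc n) - Z)
        + 1 / 2 * ((X (Suc n) - X n) \<bullet> (D ** (X (Suc n) - X n)))"
      using \<gamma>L[of "X (Suc n) - X n"] by simp
    also have "\<dots> \<le> 1 / 2 * (P n - P (Suc n)) + 1 / 2 * (Q n - Q (Suc n))"
      unfolding P_def Q_def wnorm_sq_eq_inner Srec
    proof (rule primal_dual_step)
      show "R ** (C ** V) = C ** (R ** V)" for V :: "real^'d^'m"
        by (simp add: matrix_mul_assoc RC)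
      show "W n = D ** X n - \<gamma> *\<^sub>R G (X n) - C ** S n" by (rule W_def)
      show "X (Suc n) = R ** (R ** W n)" using XY by (simp add: RRX)
    qed (use fixZ Mnonneg in \<open>auto intro: linear_matrix_mult symmetric_matrix_inner symD symR symC\<close>)
    finally show ?thesis .
  qed
  \<comment> \<open>Telescoping of \<open>step\<close>, where \<open>Q 0\<close> vanishes because
    \<open>S 0 = 0\<close>. The sum starts at 1 because \<open>step\<close> bounds the value at the
    new iterate.\<close>
  have sums: "\<gamma> * (\<Sum>t=1..n. total_fun f (X t) - total_fun f Z) \<le> 1 / 2 * (P 0 - P n) - 1 / 2 * Q n" for n
  proof (induction n)
    case 0
    show ?case by (simp add: Q_def S0 linear_0[OF linear_matrix_mult])
  next
    case (Suc n)
    then show ?case using step[of n] by (simp add: field_simps)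
  qed

  define Xh where "Xh = (1 / real k) *\<^sub>R (\<Sum>t=1..k. X t)"
  define E where "E = (mat 1 - avg_mat) ** Xh"
  define \<Delta> where "\<Delta> = total_fun f Xh - total_fun f Z"
  \<comment> \<open>Up to the factor \<open>1 / k\<close> the average is thus \<open>B S k\<close>,
    which ties its consensus error to \<open>Q k\<close>.\<close>
  have sumX: "(\<Sum>t=1..n. X t) = B ** S n" for n
    by (induction n) (use XY in \<open>auto simp: S0 Srec linear_0[OF linear_matrix_mult] linear_add[OF linear_matrix_mult]\<close>)
  \<comment> \<open>Jensen's inequality combined with \<open>sums\<close>. The final primal energy
    is nonnegative and dropped, while \<open>Q k\<close> is kept to control the consensus
    error.\<close>
  have upper: "real k * \<Delta> \<le> 1 / (2 * \<gamma>) * P 0 - Q k / (2 * \<gamma>)"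
  proof -
    have "real k * \<Delta> \<le> (\<Sum>t=1..k. total_fun f (X t) - total_fun f Z)"
      using total_fun_average[where f = f and X = X, OF cv k] k
      by (simp add: \<Delta>_def Xh_def sum_subtractf right_diff_distrib pos_le_divide_eq mult.commute)
    then have "\<gamma> * (real k * \<Delta>) \<le> \<gamma> * (\<Sum>t=1..k. total_fun f (X t) - total_fun f Z)"
      using \<gamma> by simp
    also have "\<dots> \<le> 1 / 2 * (P 0 - P k) - 1 / 2 * Q k" by (rule sums)
    also have "\<dots> \<le> 1 / 2 * P 0 - 1 / 2 * Q k"
    proof -
      have "0 \<le> P k"
        unfolding P_def wnorm_sq_eq_inner using \<gamma>L[of "X k - Z"] \<gamma> L
        by (meson inner_ge_zero mult_nonneg_nonneg less_imp_le order_trans)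
      then show ?thesis by simp
    qed
    finally show ?thesis using \<gamma> by (simp add: field_simps)
  qed
  have sumG: "(\<Sum>i\<in>UNIV. G Z $ i) = 0"
    unfolding G_def Z_def
  proof (rule sum_stacked_grad_minimizer[OF sm])
    show "(\<Sum>i\<in>UNIV. f i xs) \<le> (\<Sum>i\<in>UNIV. f i x)" for x
      using assms(3)[of x] by (simp add: divide_le_cancel)
  qed
  have JG: "avg_mat ** G Z = 0" using sumG by (rule avg_mat_mult_eq_0)
  \<comment> \<open>By optimality the rows of \<open>G Z\<close> sum to zero, so \<open>G Z\<close>
    is orthogonal to \<open>Z\<close> and to the mean part of \<open>Xh\<close>; only
    \<open>E\<close> survives in the convexity bound.\<close>
  have lower: "- (norm (G Z) * norm E) \<le> \<Delta>"
  proof -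
    have "G Z \<bullet> Z = 0" using inner_consensus[of xs "G Z"] sumG by (simp add: Z_def inner_commute)
    moreover have "G Z \<bullet> (avg_mat ** Xh) = 0"
      using symmetric_matrix_inner[OF transpose_avg_mat, of "G Z" Xh] JG by simp
    ultimately have "G Z \<bullet> (Xh - Z) = G Z \<bullet> E"
      by (simp add: E_def matrix_mult_diff_left inner_diff_right)
    moreover have "- (norm (G Z) * norm E) \<le> G Z \<bullet> E"
      using Cauchy_Schwarz_ineq2[of "G Z" E] by linarith
    ultimately show ?thesis
      using total_fun_lower_bound[where f = f and Z = Z and Y = Xh, OF sm cv] by (simp add: \<Delta>_def G_def)
  qed
  have Q: "0 \<le> Q k" unfolding Q_def by (rule psd_matrix_inner[OF psdC])
  have P: "0 \<le> 1 / (2 * \<gamma>) * P 0"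
    unfolding P_def wnorm_sq_eq_inner using \<gamma>L[of "X 0 - Z"] \<gamma> L
    by (meson inner_ge_zero mult_nonneg_nonneg less_imp_le order_trans zero_le_divide_1_iff zero_le_numeral)
  \<comment> \<open>Splitting \<open>B\<close> as \<open>R R\<close> lets
    \<open>consensus_error_le\<close> be applied with the columns of \<open>R S k\<close> as
    \<open>t\<close>, the same columns that make up \<open>Q k\<close>.\<close>
  have kE: "real k *\<^sub>R E = (mat 1 - avg_mat) ** (R ** (R ** S k))"
    using k unfolding E_def Xh_def sumX RRX by (simp add: linear_scale[OF linear_matrix_mult])
  let ?c = "spectral_radius (B - avg_mat) / lambda2 C"
  \<comment> \<open>With a single agent \<open>lambda2 C\<close> is unspecified and
    \<open>?c\<close> has no known sign, whereas \<open>merit_bound_from_energy\<close> requires a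
    nonnegative constant. Hence \<open>c\<close> has to agree with \<open>?c\<close> only after
    multiplication by the squared gradient norm.\<close>
  have "\<exists>c\<ge>0. c * (norm (G Z))\<^sup>2 = ?c * (norm (G Z))\<^sup>2 \<and>
      (real k * norm E * norm (G Z))\<^sup>2 \<le> c * (norm (G Z))\<^sup>2 * Q k"
  proof (cases "\<exists>z :: real^'m. 1 \<bullet> z = 0 \<and> z \<noteq> 0")
    case True
    then obtain z :: "real^'m" where z: "1 \<bullet> z = 0" "z \<noteq> 0" by blast
    have "(real k * norm E)\<^sup>2 = (norm (real k *\<^sub>R E))\<^sup>2" by simp
    also have "\<dots> = (\<Sum>j\<in>UNIV. (norm ((mat 1 - avg_mat) *v (R *v column j (R ** S k))))\<^sup>2)"
      unfolding kE by (simp add: power2_norm_eq_inner inner_eq_sum_columns column_matrix_mult)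
    also have "\<dots> \<le> (\<Sum>j\<in>UNIV. ?c * (column j (R ** S k) \<bullet> (C *v column j (R ** S k))))"
      by (intro sum_mono consensus_error_le[OF symB psdR RR R1 psdC kerC z])
    also have "\<dots> = ?c * Q k"
      by (simp add: Q_def inner_eq_sum_columns column_matrix_mult sum_distrib_left)
    finally have "(real k * norm E * norm (G Z))\<^sup>2 \<le> ?c * Q k * (norm (G Z))\<^sup>2"
      unfolding power_mult_distrib[of _ "norm (G Z)"] by (rule mult_right_mono) simp
    moreover have "0 \<le> ?c"
    proof (intro divide_nonneg_nonneg spectral_radius_bound(2))
      show "transpose (B - avg_mat) = B - avg_mat"
        using symB by (simp add: transpose_def avg_mat_def vec_eq_iff)
      show "0 \<le> lambda2 C" using lambda2_pos[OF psdC kerC _ z] by simp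
    qed
    ultimately show ?thesis by (intro exI[of _ ?c]) (simp add: mult_ac)
  next
    case False
    (* Only one agent: lambda2 C is unspecified, but it is multiplied by 0. *)
    have "column j (G Z) = 0" for j
    proof -
      have "1 \<bullet> ((mat 1 - avg_mat) *v column j (G Z)) = 0" by (rule avg_mat_complement_orthogonal)
      then have "(mat 1 - avg_mat) *v column j (G Z) = 0" using False by blast
      then have "column j ((mat 1 - avg_mat) ** G Z) = 0" by (simp add: column_matrix_mult)
      then show ?thesis using JG by (simp add: matrix_mult_diff_left)
    qed
    then have "G Z \<bullet> G Z = 0" by (simp add: inner_eq_sum_columns)
    then show ?thesis by (intro exI[of _ 0]) simp
  qed
  then obtain c where c: "0 \<le> c" "c * (norm (G Z))\<^sup>2 = ?c * (norm (G Z))\<^sup>2"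
    "(real k * norm E * norm (G Z))\<^sup>2 \<le> c * (norm (G Z))\<^sup>2 * Q k" by blast
  have "max (norm E * norm (G Z)) \<bar>\<Delta>\<bar>
      \<le> 1 / real k * (1 / (2 * \<gamma>) * P 0 + 2 * \<gamma> * c * (norm (G Z))\<^sup>2)"
    using k by (intro merit_bound_from_energy[OF _ \<gamma> P _ _ c(1) upper lower Q c(3)]) auto
  moreover have "2 * \<gamma> * c * (norm (G Z))\<^sup>2 = 2 * \<gamma> * ?c * (norm (G Z))\<^sup>2"
    using c(2) by (metis mult.assoc)
  ultimately show ?thesis
    unfolding merit_def E_def Xh_def \<Delta>_def P_def G_def Z_def by simp
qed

end
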